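(* Suppose the bilevel problem has a local real pessimistic solution. (I) If for every local real pessimistic solution $x$ of the bilevel problem there is $y\in\psi(x)$ with $F_p(x)=F(x,y)$, then every local real pessimistic solution of the bilevel problem is a local $u$-minimal solution of the set-valued formulation. (II) If $x^0$ is a local real pessimistic solution of the bilevel problem for which there is no $y\in\psi(x^0)$ with $F_p(x^0)=F(x^0,y)$, then $x^0$ is a local $u$-minimal solution of the set-valued formulation.
   Context: Setting. $\mathcal{X},\mathcal{Y}$ are real normed linear spaces, $X\subseteq\mathcal{X}$ is nonempty, $F:\mathcal{X}\times\mathcal{Y}\to\mathbb{R}$ is the upper-level objective. For each $x\in X$, $K(x)\subseteq\mathcal{Y}$ is the lower-level constraint set, $f$ is the real-valued lower-level objective, and $\psi(x)=\arg\min_y\{f(x,y)\mid y\in K(x)\}$ is the set of global minimizers of $f(x,\cdot)$ over $K(x)$. Standing assumption: $\psi(x)\neq\emptyset$ for every $x\in X$. The bilevel problem is: "minimize" over $x$ the value $F(x,y)$ subject to $x\in X$, $y\in\psi(x)$. $F_p(x)=\sup_{y\in\psi(x)}F(x,y)$ for $x\in X$ (possibly $+\infty$; attainment is not assumed). A point $x^*\in X$ is a local real pessimistic solution of the bilevel problem if there is $\epsilon>0$ such that $F_p(x)\ge F_p(x^* )$ for all $x\in X$ with $\|x-x^*\|<\epsilon$. Set-valued formulation: minimize $F(x,\psi(x))$ over $x\in X$, where $F(x,\psi(x)):=\{F(x,y)\mid y\in\psi(x)\}\subseteq\mathbb{R}$. $\mathbb{R}$ carries its usual order, induced by the cone $C=\mathbb{R}_+=[0,\infty)$.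 For nonempty $A,B\subseteq\mathbb{R}$, $A\le_C^u B$ means $A\subseteq B-C$. A point $x^0\in X$ is a local $u$-minimal solution of the set-valued formulation if there is $\epsilon>0$ such that for every $x\in X$ with $\|x-x^0\|<\epsilon$ and $F(x,\psi(x))\le_C^u F(x^0,\psi(x^0))$ one has $F(x^0,\psi(x^0))\le_C^u F(x,\psi(x))$. *)

theory Defs
  imports Complex_Main "HOL-Library.Extended_Real"
begin

text \<open>
  The constraint set-valued map is \<open>K\<close>, the lower-level objective is \<open>f\<close> and the upper-level
  objective is \<open>F\<close>; functions of two variables are curried.
\<close>

definition lower_solutions :: "('a \<Rightarrow> 'b \<Rightarrow> real) \<Rightarrow> ('a \<Rightarrow> 'b set) \<Rightarrow> 'a \<Rightarrow> 'b set"
  where "lower_solutions f K x = {y. is_arg_min (f x) (\<lambda>y. y \<in> K x) y}"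

text \<open>The supremum is taken in the extended reals, since it may be infinite.\<close>

definition pessimistic_value ::
    "('a \<Rightarrow> 'b \<Rightarrow> real) \<Rightarrow> ('a \<Rightarrow> 'b \<Rightarrow> real) \<Rightarrow> ('a \<Rightarrow> 'b set) \<Rightarrow> 'a \<Rightarrow> ereal"
  where "pessimistic_value F f K x = (SUP y \<in> lower_solutions f K x. ereal (F x y))"

definition local_pessimistic_solution ::
    "'a::real_normed_vector set \<Rightarrow> ('a \<Rightarrow> 'b \<Rightarrow> real) \<Rightarrow> ('a \<Rightarrow> 'b \<Rightarrow> real) \<Rightarrow>
     ('a \<Rightarrow> 'b set) \<Rightarrow> 'a \<Rightarrow> bool"
  where "local_pessimistic_solution X F f K x0 \<longleftrightarrow>
    x0 \<in> X \<and>
    (\<exists>\<epsilon>>0. \<forall>x\<in>X. norm (x - x0) < \<epsilon> \<longrightarrow>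
       pessimistic_value F f K x \<ge> pessimistic_value F f K x0)"

text \<open>
  The upper set relation induced by a cone \<open>C\<close>.  The difference \<open>B - C\<close> in its definition is the
  Minkowski difference, written out because \<open>-\<close> on sets denotes the set difference.
\<close>

definition u_le :: "'z::real_vector set \<Rightarrow> 'z set \<Rightarrow> 'z set \<Rightarrow> bool"
  where "u_le C A B \<longleftrightarrow> A \<subseteq> {b - c | b c. b \<in> B \<and> c \<in> C}"

definition local_u_minimal ::
    "'z::real_vector set \<Rightarrow> 'a::real_normed_vector set \<Rightarrow> ('a \<Rightarrow> 'z set) \<Rightarrow> 'a \<Rightarrow> bool"
  where "local_u_minimal C X G x0 \<longleftrightarrow>
    x0 \<in> X \<and>
    (\<exists>\<epsilon>>0. \<forall>x\<in>X. norm (x - x0) < \<epsilon> \<and> u_le C (G x) (G x0) \<longrightarrow> u_le C (G x0) (G x))"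

definition upper_image ::
    "('a \<Rightarrow> 'b \<Rightarrow> real) \<Rightarrow> ('a \<Rightarrow> 'b \<Rightarrow> real) \<Rightarrow> ('a \<Rightarrow> 'b set) \<Rightarrow> 'a \<Rightarrow> real set"
  where "upper_image F f K x = F x ` lower_solutions f K x"

end

theory Submission
  imports Defs
begin

text \<open>
  For sets of reals the relation \<open>u_le {0..} A B\<close> is almost a comparison of suprema.  It
  implies \<open>Sup A \<le> Sup B\<close>; conversely, \<open>Sup A \<le> Sup B\<close> implies \<open>u_le {0..} A B\<close> except when
  \<open>A\<close> attains its supremum, \<open>B\<close> does not, and the two suprema agree.  The supremum of the set
  \<open>upper_image F f K x\<close> is \<open>pessimistic_value F f K x\<close>, and near a local pessimistic solution
  \<open>x0\<close> this value is at least the one at \<open>x0\<close>.  So the inequality of suprema required for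
  u-minimality is available, and only the exceptional case can go wrong.

  If the value at \<open>x0\<close> is not attained, the exceptional case cannot occur.  If it is attained,
  a nearby \<open>x\<close> with \<open>u_le {0..} (upper_image F f K x) (upper_image F f K x0)\<close> has the same
  pessimistic value as \<open>x0\<close>, hence is itself a local pessimistic solution
  (\<open>local_pessimistic_solution_transfer\<close>).  Attainment at every local pessimistic solution, the
  hypothesis of the first part, then gives attainment at \<open>x\<close> and again excludes the
  exceptional case.
\<close>

lemma u_le_real_iff:
  fixes A B :: "real set"
  shows "u_le {0..} A B \<longleftrightarrow> (\<forall>a\<in>A. \<exists>b\<in>B. a \<le> b)"
proof
  assume le: "u_le {0..} A B"
  show "\<forall>a\<in>A. \<exists>b\<in>B. a \<le> b"
  proof
    fix a assume "a \<in> A"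
    with le obtain b c where "a = b - c" "b \<in> B" "c \<ge> 0"
      unfolding u_le_def by blast
    then show "\<exists>b\<in>B. a \<le> b" by (intro bexI[of _ b]) auto
  qed
next
  assume dom: "\<forall>a\<in>A. \<exists>b\<in>B. a \<le> b"
  show "u_le {0..} A B"
    unfolding u_le_def
  proof
    fix a assume "a \<in> A"
    with dom obtain b where "b \<in> B" "a \<le> b" by blast
    then have "a = b - (b - a)" "b - a \<in> {0..}" by auto
    with \<open>b \<in> B\<close> show "a \<in> {b - c | b c. b \<in> B \<and> c \<in> {0..}}" by blast
  qed
qed

lemma u_le_imp_Sup_le:
  fixes A B :: "real set"
  assumes "u_le {0..} A B"
  shows "Sup (ereal ` A) \<le> Sup (ereal ` B)"
  using assms unfolding u_le_real_iff by (intro SUP_mono) auto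

text \<open>
  An element of \<open>A\<close> strictly below \<open>Sup B\<close> is exceeded by some element of \<open>B\<close>.  An element equal
  to \<open>Sup B\<close> is then a maximum of \<open>A\<close>, which by hypothesis is possible only if \<open>B\<close> has a maximum
  as well.
\<close>

lemma Sup_le_imp_u_le:
  fixes A B :: "real set"
  assumes le: "Sup (ereal ` A) \<le> Sup (ereal ` B)"
    and attained: "Sup (ereal ` A) \<in> ereal ` A \<Longrightarrow> Sup (ereal ` B) \<in> ereal ` B"
  shows "u_le {0..} A B"
  unfolding u_le_real_iff
proof
  fix a assume a: "a \<in> A"
  then have aA: "ereal a \<le> Sup (ereal ` A)" by (simp add: SUP_upper)
  show "\<exists>b\<in>B. a \<le> b"
  proof (cases "ereal a < Sup (ereal ` B)")
    case True
    then show ?thesis by (auto simp: less_SUP_iff intro: less_imp_le)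
  next
    case False
    with aA le have "Sup (ereal ` A) = ereal a" "Sup (ereal ` B) = ereal a" by auto
    with attained a show ?thesis by force
  qed
qed

lemma pessimistic_value_eq_Sup:
  "pessimistic_value F f K x = Sup (ereal ` upper_image F f K x)"
  by (simp add: pessimistic_value_def upper_image_def image_image)

text \<open>
  A point \<open>x\<close> of the open ball of radius \<open>\<epsilon>\<close> around \<open>x0\<close> is the centre of a smaller ball inside
  it, so a lower bound that is valid on the whole ball makes \<open>x\<close> a local solution as soon as the
  value at \<open>x\<close> does not exceed that bound.
\<close>

lemma local_pessimistic_solution_transfer:
  assumes bound: "\<And>z. z \<in> X \<Longrightarrow> norm (z - x0) < \<epsilon> \<Longrightarrow>
      pessimistic_value F f K x0 \<le> pessimistic_value F f K z"
    and x: "x \<in> X" "norm (x - x0) < \<epsilon>"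
    and le: "pessimistic_value F f K x \<le> pessimistic_value F f K x0"
  shows "local_pessimistic_solution X F f K x"
  unfolding local_pessimistic_solution_def
proof (intro conjI exI[of _ "\<epsilon> - norm (x - x0)"] ballI impI)
  fix z assume z: "z \<in> X" "norm (z - x) < \<epsilon> - norm (x - x0)"
  have "norm (z - x0) \<le> norm (z - x) + norm (x - x0)"
    using norm_triangle_ineq[of "z - x" "x - x0"] by simp
  with z have "norm (z - x0) < \<epsilon>" by linarith
  with bound[OF z(1)] le show "pessimistic_value F f K x \<le> pessimistic_value F f K z"
    by (blast intro: order_trans)
qed (use x in auto)

text \<open>
  Both parts of the theorem are instances of this lemma: in the first one the conclusion of
  \<open>attained\<close> always holds, in the second one its second premise fails.
\<close>

lemma local_pessimistic_imp_local_u_minimal: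
  assumes sol: "local_pessimistic_solution X F f K x0"
    and attained: "\<And>x. local_pessimistic_solution X F f K x \<Longrightarrow>
      pessimistic_value F f K x0 \<in> ereal ` upper_image F f K x0 \<Longrightarrow>
      pessimistic_value F f K x \<in> ereal ` upper_image F f K x"
  shows "local_u_minimal {0..} X (upper_image F f K) x0"
proof -
  from sol obtain \<epsilon> where x0: "x0 \<in> X" and \<epsilon>: "\<epsilon> > 0"
    and bound: "\<And>z. z \<in> X \<Longrightarrow> norm (z - x0) < \<epsilon> \<Longrightarrow>
      pessimistic_value F f K x0 \<le> pessimistic_value F f K z"
    unfolding local_pessimistic_solution_def by blast
  have "u_le {0..} (upper_image F f K x0) (upper_image F f K x)"
    if x: "x \<in> X" "norm (x - x0) < \<epsilon>"
      and dom: "u_le {0..} (upper_image F f K x) (upper_image F f K x0)" for x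
  proof -
    from dom have "pessimistic_value F f K x \<le> pessimistic_value F f K x0"
      unfolding pessimistic_value_eq_Sup by (rule u_le_imp_Sup_le)
    with bound x have "local_pessimistic_solution X F f K x"
      by (rule local_pessimistic_solution_transfer)
    from bound[OF x] attained[OF this] show ?thesis
      unfolding pessimistic_value_eq_Sup by (rule Sup_le_imp_u_le)
  qed
  with x0 \<epsilon> show ?thesis unfolding local_u_minimal_def by blast
qed

theorem theorem16:
  fixes X :: "'a::real_normed_vector set"
    and K :: "'a \<Rightarrow> 'b::real_normed_vector set"
    and f F :: "'a \<Rightarrow> 'b \<Rightarrow> real"
  assumes "X \<noteq> {}"
    and "\<And>x. x \<in> X \<Longrightarrow> lower_solutions f K x \<noteq> {}"
    and "\<exists>x. local_pessimistic_solution X F f K x"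
  shows "((\<forall>x. local_pessimistic_solution X F f K x \<longrightarrow>
             (\<exists>y\<in>lower_solutions f K x. pessimistic_value F f K x = ereal (F x y)))
          \<longrightarrow> (\<forall>x. local_pessimistic_solution X F f K x \<longrightarrow>
                 local_u_minimal {0..} X (upper_image F f K) x))
       \<and> (\<forall>x0. local_pessimistic_solution X F f K x0 \<and>
             \<not> (\<exists>y\<in>lower_solutions f K x0. pessimistic_value F f K x0 = ereal (F x0 y))
          \<longrightarrow> local_u_minimal {0..} X (upper_image F f K) x0)"
proof -
  have attained_iff: "pessimistic_value F f K x \<in> ereal ` upper_image F f K x \<longleftrightarrow>
      (\<exists>y\<in>lower_solutions f K x. pessimistic_value F f K x = ereal (F x y))" for x
    by (auto simp: upper_image_def)
  show ?thesis
    unfolding attained_iff[symmetric]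
    by (intro conjI allI impI; rule local_pessimistic_imp_local_u_minimal) blast+
qed

end
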